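(* Let $F$ be a euclidean field, and let $\mathcal Q=\left(\frac{-1,-1}{F}\right)$. Then the multiplicative group $\mathcal Q^*$ contains a maximal subgroup.
   Context: A field $F$ is euclidean if it has an ordering with respect to which every positive element is a square. $\left(\frac{-1,-1}{F}\right)$ is the quaternion algebra over $F$ with $F$-base $\{1,\mathbf i,\mathbf j,\mathbf k\}$, $\mathbf i^2=\mathbf j^2=-1$, $\mathbf k=\mathbf i\mathbf j=-\mathbf j\mathbf i$; it is a division algebra when $F$ is euclidean, and $\mathcal Q^*=\mathcal Q\setminus\{0\}$. A maximal subgroup of a group is a proper subgroup not contained in any other proper subgroup. *)

theory Defs
  imports "HOL-Algebra.Group"
begin

text \<open>The ordering is existentially quantified, so being euclidean is a property of the field
  alone; \<^class>\<open>field\<close> itself carries no order.\<close>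

definition field_ordering :: "('a::field \<Rightarrow> 'a \<Rightarrow> bool) \<Rightarrow> ('a \<Rightarrow> 'a \<Rightarrow> bool) \<Rightarrow> bool" where
  "field_ordering leF ltF \<longleftrightarrow>
     class.linorder leF ltF \<and>
     (\<forall>a b c. leF a b \<longrightarrow> leF (a + c) (b + c)) \<and>
     (\<forall>a b. ltF 0 a \<longrightarrow> ltF 0 b \<longrightarrow> ltF 0 (a * b))"

definition euclidean_field :: "'a::field itself \<Rightarrow> bool" where
  "euclidean_field _ \<longleftrightarrow>
     (\<exists>(leF :: 'a \<Rightarrow> 'a \<Rightarrow> bool) ltF. field_ordering leF ltF \<and> (\<forall>a. ltF 0 a \<longrightarrow> (\<exists>b. a = b * b)))"

text \<open>The element with coordinates \<open>a, b, c, d\<close> is \<open>a + b i + c j + d k\<close>.\<close>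

datatype 'a quaternion = Quaternion (q_re: 'a) (q_i: 'a) (q_j: 'a) (q_k: 'a)

lemma quaternion_eq_iff:
  "x = y \<longleftrightarrow> q_re x = q_re y \<and> q_i x = q_i y \<and> q_j x = q_j y \<and> q_k x = q_k y"
  by (cases x; cases y) simp

instantiation quaternion :: (field) ring_1
begin

definition zero_quaternion :: "'a quaternion" where
  "0 = Quaternion 0 0 0 0"

definition one_quaternion :: "'a quaternion" where
  "1 = Quaternion 1 0 0 0"

definition plus_quaternion :: "'a quaternion \<Rightarrow> 'a quaternion \<Rightarrow> 'a quaternion" where
  "x + y = Quaternion (q_re x + q_re y) (q_i x + q_i y) (q_j x + q_j y) (q_k x + q_k y)"

definition uminus_quaternion :: "'a quaternion \<Rightarrow> 'a quaternion" where
  "- x = Quaternion (- q_re x) (- q_i x) (- q_j x) (- q_k x)"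

definition minus_quaternion :: "'a quaternion \<Rightarrow> 'a quaternion \<Rightarrow> 'a quaternion" where
  "x - y = Quaternion (q_re x - q_re y) (q_i x - q_i y) (q_j x - q_j y) (q_k x - q_k y)"

definition times_quaternion :: "'a quaternion \<Rightarrow> 'a quaternion \<Rightarrow> 'a quaternion" where
  "x * y = Quaternion
     (q_re x * q_re y - q_i x * q_i y - q_j x * q_j y - q_k x * q_k y)
     (q_re x * q_i y + q_i x * q_re y + q_j x * q_k y - q_k x * q_j y)
     (q_re x * q_j y - q_i x * q_k y + q_j x * q_re y + q_k x * q_i y)
     (q_re x * q_k y + q_i x * q_j y - q_j x * q_i y + q_k x * q_re y)"

instance
  by standard
     (simp_all add: zero_quaternion_def one_quaternion_def plus_quaternion_def
        uminus_quaternion_def minus_quaternion_def times_quaternion_def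
        quaternion_eq_iff algebra_simps)

end

lemmas quaternion_defs =
  zero_quaternion_def one_quaternion_def plus_quaternion_def
  uminus_quaternion_def minus_quaternion_def times_quaternion_def

definition quat_of :: "'a::field \<Rightarrow> 'a quaternion" where
  "quat_of a = Quaternion a 0 0 0"

definition quat_i :: "'a::field quaternion" where
  "quat_i = Quaternion 0 1 0 0"

definition quat_j :: "'a::field quaternion" where
  "quat_j = Quaternion 0 0 1 0"

definition quat_k :: "'a::field quaternion" where
  "quat_k = Quaternion 0 0 0 1"

text \<open>The following facts characterise the algebra: \<open>quat_of\<close> is a central embedding of the
  field, \<open>1, i, j, k\<close> is a basis, and the defining relations hold.\<close>

lemma quat_of_hom:
  "quat_of (a + b) = quat_of a + quat_of b"
  "quat_of (a * b) = quat_of a * quat_of b"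
  "quat_of 1 = 1"
  "quat_of a * x = x * quat_of a"
  by (simp_all add: quat_of_def quaternion_defs mult.commute)

lemma quat_basis:
  "Quaternion a b c d = quat_of a + quat_of b * quat_i + quat_of c * quat_j + quat_of d * quat_k"
  by (simp add: quat_of_def quat_i_def quat_j_def quat_k_def quaternion_defs)

lemma quat_relations:
  "quat_i * quat_i = - 1"
  "quat_j * quat_j = - 1"
  "quat_i * quat_j = quat_k"
  "quat_j * quat_i = - quat_k"
  by (simp_all add: quat_i_def quat_j_def quat_k_def quaternion_defs)

definition quat_mult_group :: "'a::field quaternion monoid" where
  "quat_mult_group = \<lparr>carrier = UNIV - {0}, mult = (*), one = 1\<rparr>"

definition maximal_subgroup :: "'g set \<Rightarrow> ('g, 'm) monoid_scheme \<Rightarrow> bool" where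
  "maximal_subgroup H G \<longleftrightarrow>
     subgroup H G \<and> H \<noteq> carrier G \<and>
     (\<forall>K. subgroup K G \<and> K \<noteq> carrier G \<and> H \<subseteq> K \<longrightarrow> K = H)"

text \<open>Over a euclidean field the nonzero quaternions do form a group, so the notions above are
  applied to a genuine group.\<close>

lemma field_ordering_squares:
  fixes leF ltF :: "'a::field \<Rightarrow> 'a \<Rightarrow> bool"
  assumes ord: "field_ordering leF ltF"
  shows "leF 0 (a * a)" and "a \<noteq> 0 \<Longrightarrow> ltF 0 (a * a)"
    and "leF 0 x \<Longrightarrow> leF 0 y \<Longrightarrow> leF 0 (x + y)"
    and "ltF 0 x \<Longrightarrow> leF 0 y \<Longrightarrow> ltF 0 (x + y)"
proof -
  interpret linorder leF ltF
    using ord by (simp add: field_ordering_def)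
  have add: "leF (x + z) (y + z)" if "leF x y" for x y z
    using ord that by (simp add: field_ordering_def)
  have mul: "ltF 0 (x * y)" if "ltF 0 x" "ltF 0 y" for x y
    using ord that by (simp add: field_ordering_def)
  show pos: "ltF 0 (a * a)" if "a \<noteq> 0" for a
  proof (cases "ltF 0 a")
    case True
    show ?thesis by (rule mul [OF True True])
  next
    case False
    then have "leF a 0" by simp
    from add [OF this, of "- a"] have "leF 0 (- a)" by simp
    with that have "ltF 0 (- a)" by (simp add: le_less)
    from mul [OF this this] show ?thesis by simp
  qed
  show "leF 0 (a * a)"
    using pos [of a] by (cases "a = 0") (simp_all add: less_imp_le)
  have step: "leF x (x + y)" if "leF 0 y" for x y
    using add [OF that, of x] by (simp add: add.commute)
  show "leF 0 (x + y)" if "leF 0 x" "leF 0 y"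
    using order_trans [OF that(1) step [OF that(2)]] .
  show "ltF 0 (x + y)" if "ltF 0 x" "leF 0 y"
    using less_le_trans [OF that(1) step [OF that(2)]] .
qed

lemma quat_norm_nonzero:
  fixes x :: "'a::field quaternion"
  assumes "euclidean_field TYPE('a)" and "x \<noteq> 0"
  shows "q_re x * q_re x + q_i x * q_i x + q_j x * q_j x + q_k x * q_k x \<noteq> 0" (is "?N \<noteq> 0")
proof -
  obtain leF ltF :: "'a \<Rightarrow> 'a \<Rightarrow> bool" where ord: "field_ordering leF ltF"
    using assms(1) by (auto simp: euclidean_field_def)
  interpret linorder leF ltF
    using ord by (simp add: field_ordering_def)
  note sq = field_ordering_squares [OF ord]
  have sum: "p + q + r + s \<noteq> 0" if "ltF 0 p" "leF 0 q" "leF 0 r" "leF 0 s" for p q r s :: 'a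
    using sq(4) [OF sq(4) [OF sq(4) [OF that(1,2)] that(3)] that(4)] by auto
  consider "q_re x \<noteq> 0" | "q_i x \<noteq> 0" | "q_j x \<noteq> 0" | "q_k x \<noteq> 0"
    using assms(2) by (auto simp: quaternion_eq_iff zero_quaternion_def)
  then show ?thesis
  proof cases
    case 1
    from sum [OF sq(2) [OF this] sq(1) sq(1) sq(1)] show ?thesis .
  next
    case 2
    from sum [OF sq(2) [OF this] sq(1) sq(1) sq(1), of "q_re x" "q_j x" "q_k x"]
    show ?thesis by (simp add: ac_simps)
  next
    case 3
    from sum [OF sq(2) [OF this] sq(1) sq(1) sq(1), of "q_re x" "q_i x" "q_k x"]
    show ?thesis by (simp add: ac_simps)
  next
    case 4
    from sum [OF sq(2) [OF this] sq(1) sq(1) sq(1), of "q_re x" "q_i x" "q_j x"]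
    show ?thesis by (simp add: ac_simps)
  qed
qed

lemma quat_left_inverse:
  fixes x :: "'a::field quaternion"
  assumes "euclidean_field TYPE('a)" and "x \<noteq> 0"
  shows "\<exists>y. y * x = 1"
proof -
  define N where "N = q_re x * q_re x + q_i x * q_i x + q_j x * q_j x + q_k x * q_k x"
  have N: "N \<noteq> 0"
    using quat_norm_nonzero [OF assms] by (simp add: N_def)
  define z where "z = Quaternion (q_re x) (- q_i x) (- q_j x) (- q_k x)"
  have "z * x = quat_of N"
    by (simp add: z_def N_def quat_of_def times_quaternion_def algebra_simps)
  then have "(quat_of (inverse N) * z) * x = 1"
    using N by (simp add: mult.assoc flip: quat_of_hom(2,3))
  then show ?thesis ..
qed

lemma group_quat_mult_group:
  assumes "euclidean_field TYPE('a::field)"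
  shows "group (quat_mult_group :: 'a quaternion monoid)"
proof (rule groupI)
  have inv: "\<exists>z. z * x = 1" if "x \<noteq> 0" for x :: "'a quaternion"
    using quat_left_inverse [OF assms that] .
  have nz: "x * y \<noteq> 0" if "x \<noteq> 0" "y \<noteq> 0" for x y :: "'a quaternion"
    using inv [OF that(1)] that(2) by (metis mult.assoc mult_1_left mult_zero_right)
  show "x \<otimes>\<^bsub>quat_mult_group\<^esub> y \<in> carrier quat_mult_group"
    if "x \<in> carrier quat_mult_group" "y \<in> carrier quat_mult_group" for x y :: "'a quaternion"
    using that nz by (simp add: quat_mult_group_def)
  show "\<exists>y\<in>carrier quat_mult_group. y \<otimes>\<^bsub>quat_mult_group\<^esub> x = \<one>\<^bsub>quat_mult_group\<^esub>"
    if "x \<in> carrier quat_mult_group" for x :: "'a quaternion"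
    using that inv [of x] by (auto simp: quat_mult_group_def)
qed (simp_all add: quat_mult_group_def mult.assoc)

end

theory Submission
  imports Defs
begin

text \<open>
  Let \<open>C\<close> be the multiplicative group of the subfield \<open>F(i)\<close> and let \<open>g = i + j\<close>, so that
  \<open>g i = j g\<close> and conjugation by \<open>g\<close> carries \<open>C\<close> onto the multiplicative group of \<open>F(j)\<close>.
  As with Euler angles for rotations of 3-space, every nonzero quaternion is a product
  \<open>c d c'\<close> with \<open>c, c'\<close> in \<open>C\<close> and \<open>d\<close> in \<open>F(j)\<close>, so \<open>C\<close> and \<open>g\<close> together generate the whole
  group (\<open>subgroup_eq_carrier_if_complex_units_and_swap\<close>). The angles of this decomposition
  exist because sums of two squares have square roots in \<open>F\<close>
  (\<open>conjugate_into_j_subfield\<close>).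

  A group that is generated by a proper subgroup and one further element \<open>g\<close> has a maximal
  subgroup (\<open>maximal_subgroup_exists_if_generated_by_one_more\<close>): among the subgroups that contain
  the given one and avoid \<open>g\<close>, Zorn's lemma yields a maximal one, and anything strictly larger
  contains \<open>g\<close> and hence everything.

  Zorn's lemma takes the place of an explicit maximal subgroup. The natural candidate is the
  normaliser of \<open>C\<close>, which is maximal over the reals; but if the order of \<open>F\<close> is not archimedean,
  the quaternions that move the axis of \<open>i\<close> by an infinitesimal angle form a proper subgroup
  that is strictly larger.
\<close>

section \<open>Maximal subgroups from Zorn's lemma\<close>

lemma (in group) subgroup_Union_chain:
  assumes ne: "\<C> \<noteq> {}"
    and sub: "\<And>K. K \<in> \<C> \<Longrightarrow> subgroup K G"
    and chain: "\<And>K L. K \<in> \<C> \<Longrightarrow> L \<in> \<C> \<Longrightarrow> K \<subseteq> L \<or> L \<subseteq> K"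
  shows "subgroup (\<Union>\<C>) G"
proof (rule subgroupI)
  show "\<Union>\<C> \<subseteq> carrier G"
    using sub subgroup.subset by blast
  show "\<Union>\<C> \<noteq> {}"
    using ne sub subgroup.one_closed by blast
  show "inv a \<in> \<Union>\<C>" if "a \<in> \<Union>\<C>" for a
  proof -
    from that obtain K where "K \<in> \<C>" "a \<in> K" by blast
    with subgroup.m_inv_closed [OF sub] show ?thesis by blast
  qed
  show "a \<otimes> b \<in> \<Union>\<C>" if "a \<in> \<Union>\<C>" "b \<in> \<Union>\<C>" for a b
  proof -
    from that obtain K L where "K \<in> \<C>" "a \<in> K" "L \<in> \<C>" "b \<in> L" by blast
    with chain [of K L] obtain M where "M \<in> \<C>" "a \<in> M" "b \<in> M" by blast
    with subgroup.m_closed [OF sub] show ?thesis by blast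
  qed
qed

text \<open>Avoiding \<open>g\<close>, unlike being proper in general, passes to unions of chains; under the generation
  hypothesis the two conditions agree for the subgroups containing \<open>H\<close>.\<close>

lemma (in group) maximal_subgroup_exists_if_generated_by_one_more:
  assumes H: "subgroup H G" and g: "g \<in> carrier G" "g \<notin> H"
    and gen: "\<And>K. subgroup K G \<Longrightarrow> H \<subseteq> K \<Longrightarrow> g \<in> K \<Longrightarrow> K = carrier G"
  shows "\<exists>M. maximal_subgroup M G"
proof -
  define \<A> where "\<A> = {K. subgroup K G \<and> H \<subseteq> K \<and> g \<notin> K}"
  have "\<A> \<noteq> {}"
    using H g by (auto simp: \<A>_def)
  moreover have "\<Union>\<C> \<in> \<A>" if "\<C> \<noteq> {}" "subset.chain \<A> \<C>" for \<C>
  proof -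
    have mem: "K \<in> \<A>" if "K \<in> \<C>" for K
      using \<open>subset.chain \<A> \<C>\<close> that by (auto simp: subset_chain_def)
    have "subgroup (\<Union>\<C>) G"
      using that mem by (intro subgroup_Union_chain) (auto simp: \<A>_def subset_chain_def)
    moreover have "H \<subseteq> \<Union>\<C>"
      using \<open>\<C> \<noteq> {}\<close> mem by (auto simp: \<A>_def)
    moreover have "g \<notin> \<Union>\<C>"
      using mem by (auto simp: \<A>_def)
    ultimately show ?thesis by (simp add: \<A>_def)
  qed
  ultimately obtain M where M: "M \<in> \<A>" and max: "\<And>K. K \<in> \<A> \<Longrightarrow> M \<subseteq> K \<Longrightarrow> K = M"
    using subset_Zorn_nonempty [of \<A>] by metis
  have "maximal_subgroup M G"
    unfolding maximal_subgroup_def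
  proof (intro conjI allI impI)
    show "subgroup M G" "M \<noteq> carrier G"
      using M g by (auto simp: \<A>_def)
    show "K = M" if "subgroup K G \<and> K \<noteq> carrier G \<and> M \<subseteq> K" for K
    proof -
      have "H \<subseteq> K"
        using that M by (auto simp: \<A>_def)
      with that gen [of K] have "K \<in> \<A>"
        by (auto simp: \<A>_def)
      with that show ?thesis by (intro max) auto
    qed
  qed
  then show ?thesis ..
qed

lemma (in group) subgroup_cancel_left:
  assumes "subgroup K G" "a \<in> K" "x \<in> carrier G" "a \<otimes> x \<in> K"
  shows "x \<in> K"
proof -
  have "inv a \<otimes> (a \<otimes> x) \<in> K"
    using assms by (simp add: subgroup.m_closed subgroup.m_inv_closed)
  then show ?thesis
    using assms by (simp add: subgroup.mem_carrier flip: m_assoc)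
qed

lemma (in group) subgroup_cancel_right:
  assumes "subgroup K G" "a \<in> K" "x \<in> carrier G" "x \<otimes> a \<in> K"
  shows "x \<in> K"
proof -
  have "(x \<otimes> a) \<otimes> inv a \<in> K"
    using assms by (simp add: subgroup.m_closed subgroup.m_inv_closed)
  then show ?thesis
    using assms by (simp add: subgroup.mem_carrier m_assoc)
qed

section \<open>Generating the nonzero quaternions\<close>

text \<open>The multiplicative group of the subfield \<open>F(i)\<close>.\<close>

definition complex_units :: "'a::field quaternion set" where
  "complex_units = {x. x \<noteq> 0 \<and> q_j x = 0 \<and> q_k x = 0}"

lemma euclidean_sum_of_two_squares:
  fixes x y :: "'a::field"
  assumes "euclidean_field TYPE('a)"
  obtains r where "r * r = x * x + y * y"
proof -
  obtain leF ltF :: "'a \<Rightarrow> 'a \<Rightarrow> bool" where ord: "field_ordering leF ltF"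
    and sqrt: "\<And>a. ltF 0 a \<Longrightarrow> \<exists>b. a = b * b"
    using assms by (auto simp: euclidean_field_def)
  show thesis
  proof (cases "x = 0")
    case True
    then show thesis using that [of y] by simp
  next
    case False
    then have "ltF 0 (x * x + y * y)"
      by (intro field_ordering_squares [OF ord])
    with sqrt that show thesis by metis
  qed
qed

lemma subgroup_complex_units:
  assumes euc: "euclidean_field TYPE('a::field)"
  shows "subgroup complex_units (quat_mult_group :: 'a quaternion monoid)"
proof -
  interpret group "quat_mult_group :: 'a quaternion monoid"
    by (rule group_quat_mult_group [OF euc])
  show ?thesis
  proof (rule subgroupI)
    show "complex_units \<subseteq> carrier (quat_mult_group :: 'a quaternion monoid)"
      by (auto simp: complex_units_def quat_mult_group_def)
    have "(1 :: 'a quaternion) \<in> complex_units"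
      by (simp add: complex_units_def quaternion_defs)
    then show "(complex_units :: 'a quaternion set) \<noteq> {}" by blast
    show "inv\<^bsub>quat_mult_group\<^esub> x \<in> complex_units"
      if x: "x \<in> complex_units" for x :: "'a quaternion"
    proof -
      define N where "N = q_re x * q_re x + q_i x * q_i x"
      have N: "N \<noteq> 0"
        using x quat_norm_nonzero [OF euc, of x] by (auto simp: complex_units_def N_def)
      define y where "y = Quaternion (q_re x / N) (- q_i x / N) 0 0"
      have "y * x = 1"
        using x N
        by (simp add: complex_units_def y_def quaternion_eq_iff quaternion_defs
            N_def [symmetric] flip: add_divide_distrib)
      moreover from this have "y \<noteq> 0" by auto
      ultimately have "inv\<^bsub>quat_mult_group\<^esub> x = y"
        using x by (intro inv_equality) (auto simp: complex_units_def quat_mult_group_def)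
      with \<open>y \<noteq> 0\<close> show ?thesis by (simp add: complex_units_def y_def)
    qed
    show "x \<otimes>\<^bsub>quat_mult_group\<^esub> y \<in> complex_units"
      if "x \<in> complex_units" "y \<in> complex_units" for x y :: "'a quaternion"
      using that m_closed [of x y]
      by (simp add: complex_units_def quat_mult_group_def) (simp add: times_quaternion_def)
  qed
qed

text \<open>Rotation about the axis of \<open>i\<close>: writing the quaternion as \<open>a + w j\<close> with \<open>w = x + y i\<close>
  and \<open>r\<^sup>2 = x\<^sup>2 + y\<^sup>2\<close>, the element \<open>c = r + x - y i\<close> of \<open>F(i)\<close> is a square root of the conjugate of
  \<open>w\<close> up to a factor in \<open>F\<close>, so conjugation by \<open>c\<close> turns \<open>w j\<close> into \<open>r j\<close>.\<close>

lemma conjugate_into_j_subfield: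
  fixes a x y :: "'a::field"
  assumes euc: "euclidean_field TYPE('a)"
  obtains c r where "c \<in> complex_units"
    and "c * Quaternion a 0 x y = Quaternion a 0 r 0 * c"
proof (cases "y = 0")
  \<comment> \<open>The choice of \<open>c\<close> made for \<open>y \<noteq> 0\<close> would vanish here if \<open>r = - x\<close>.\<close>
  case True
  show thesis
    by (rule that [of 1 x]) (simp_all add: True complex_units_def quaternion_defs)
next
  case False
  obtain r where r: "r * r = x * x + y * y"
    using euclidean_sum_of_two_squares [OF euc] .
  define c where "c = Quaternion (r + x) (- y) 0 0"
  show thesis
  proof (rule that [of c r])
    show "c \<in> complex_units"
      using False by (simp add: c_def complex_units_def zero_quaternion_def)
    show "c * Quaternion a 0 x y = Quaternion a 0 r 0 * c"
      using r by (simp add: c_def times_quaternion_def algebra_simps)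
  qed
qed

text \<open>Two normalisations reduce an element to the units of \<open>F(j)\<close>, which lie in \<open>K\<close> as the
  conjugates of \<open>C\<close> by \<open>g\<close>: left multiplication by an element of \<open>C\<close> moves its
  \<open>F(i)\<close>-component into \<open>F\<close>, and conjugation by an element of \<open>C\<close> keeps that component while
  rotating the remaining \<open>w j\<close> to a multiple of \<open>j\<close>.\<close>

lemma subgroup_eq_carrier_if_complex_units_and_swap:
  fixes K :: "'a::field quaternion set"
  assumes euc: "euclidean_field TYPE('a)"
    and K: "subgroup K quat_mult_group"
    and C: "complex_units \<subseteq> K" and g: "quat_i + quat_j \<in> K"
  shows "K = carrier quat_mult_group"
proof
  interpret group "quat_mult_group :: 'a quaternion monoid"
    by (rule group_quat_mult_group [OF euc])
  have mult: "x * y \<in> K" if "x \<in> K" "y \<in> K" for x y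
    using subgroup.m_closed [OF K that] by (simp add: quat_mult_group_def)
  have cancel_left: "x \<in> K" if "c \<in> K" "x \<noteq> 0" "c * x \<in> K" for c x
    using subgroup_cancel_left [OF K, of c x] that by (simp add: quat_mult_group_def)
  have cancel_right: "x \<in> K" if "c \<in> K" "x \<noteq> 0" "x * c \<in> K" for c x
    using subgroup_cancel_right [OF K, of c x] that by (simp add: quat_mult_group_def)
  have prod_nz: "x * y \<noteq> 0" if "x \<noteq> 0" "y \<noteq> 0" for x y :: "'a quaternion"
    using m_closed [of x y] that by (simp add: quat_mult_group_def)
  show "K \<subseteq> carrier quat_mult_group"
    by (rule subgroup.subset [OF K])
  have D: "Quaternion a 0 b 0 \<in> K" if nz: "Quaternion a 0 b 0 \<noteq> 0" for a b
  proof (rule cancel_right [OF g nz])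
    have "Quaternion a b 0 0 \<in> complex_units"
      using nz by (simp add: complex_units_def zero_quaternion_def)
    then have "(quat_i + quat_j) * Quaternion a b 0 0 \<in> K"
      using g C mult by blast
    also have "(quat_i + quat_j) * Quaternion a b 0 0 = Quaternion a 0 b 0 * (quat_i + quat_j)"
      by (simp add: quat_i_def quat_j_def quaternion_defs)
    finally show "Quaternion a 0 b 0 * (quat_i + quat_j) \<in> K" .
  qed
  have real: "Quaternion a 0 x y \<in> K" if nz: "Quaternion a 0 x y \<noteq> 0" for a x y
  proof -
    obtain c r where c: "c \<in> complex_units"
      and eq: "c * Quaternion a 0 x y = Quaternion a 0 r 0 * c"
      using conjugate_into_j_subfield [OF euc] .
    from c have "c \<noteq> 0" by (simp add: complex_units_def)
    with nz have "Quaternion a 0 r 0 * c \<noteq> 0"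
      using prod_nz by (metis eq)
    then have "Quaternion a 0 r 0 \<in> K" by (intro D) auto
    with c C have "c * Quaternion a 0 x y \<in> K"
      unfolding eq by (blast intro: mult)
    with c C nz show ?thesis by (blast intro: cancel_left)
  qed
  show "carrier quat_mult_group \<subseteq> K"
  proof
    fix q :: "'a quaternion"
    assume "q \<in> carrier quat_mult_group"
    then have q: "q \<noteq> 0" by (simp add: quat_mult_group_def)
    \<comment> \<open>The conjugate of the \<open>F(i)\<close>-component of \<open>q\<close>.\<close>
    define z where "z = Quaternion (q_re q) (- q_i q) 0 0"
    show "q \<in> K"
    proof (cases "z = 0")
      case True
      then have "q = Quaternion 0 0 (q_j q) (q_k q)"
        by (simp add: z_def zero_quaternion_def quaternion_eq_iff)
      with q real show ?thesis by metis
    next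
      case False
      have "z \<in> K"
        using False C by (auto simp: complex_units_def z_def)
      obtain n x y where zq: "z * q = Quaternion n 0 x y"
        by (simp add: z_def times_quaternion_def mult.commute)
      have "z * q \<in> K"
        using real prod_nz [OF False q] by (simp add: zq)
      with \<open>z \<in> K\<close> q show ?thesis by (blast intro: cancel_left)
    qed
  qed
qed

theorem theorem16:
  assumes "euclidean_field TYPE('a::field)"
  shows "\<exists>H. maximal_subgroup H (quat_mult_group :: 'a quaternion monoid)"
proof (rule group.maximal_subgroup_exists_if_generated_by_one_more)
  show "group (quat_mult_group :: 'a quaternion monoid)"
    by (rule group_quat_mult_group [OF assms])
  show "subgroup complex_units (quat_mult_group :: 'a quaternion monoid)"
    by (rule subgroup_complex_units [OF assms])
  show "quat_i + quat_j \<in> carrier (quat_mult_group :: 'a quaternion monoid)"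
    by (simp add: quat_mult_group_def quat_i_def quat_j_def quaternion_defs)
  show "(quat_i + quat_j :: 'a quaternion) \<notin> complex_units"
    by (simp add: complex_units_def quat_i_def quat_j_def quaternion_defs)
  show "K = carrier quat_mult_group"
    if "subgroup K quat_mult_group" "complex_units \<subseteq> K" "quat_i + quat_j \<in> K"
    for K :: "'a quaternion set"
    using subgroup_eq_carrier_if_complex_units_and_swap [OF assms that] .
qed

end
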